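(* Consider a network Cournot game with a system operator (NCGSO) on a market network $(A,B,c^-,c^+,H)$ with $H=I$ the identity matrix, with production cost functions $\Psi_i:\mathbb{R}_+^m\to\mathbb{R}_+$ ($i\in\mathcal N$), inverse demand functions $\Phi_j:\mathbb{R}\to\mathbb{R}$ ($j\in\mathcal M$), and Walrasian welfare $$\omega(x,z)=\sum_{j\in\mathcal M}\int_0^{z_j}\Phi_j(s)\,\mathrm{d}s-\sum_{i\in\mathcal N}\Psi_i(x_i).$$ For $x\in\mathcal X$ and $y\in\mathcal B_0(x)$ (a best response of the system operator to $x$), let $z=\operatorname{diag}(A'x)+By$. Then, for every nonempty proper subset of markets $\mathcal U\subsetneq\mathcal M$ such that $$\max_{j\in\mathcal U}\Phi_j(z_j)<\min_{j\in\mathcal M\setminus\mathcal U}\Phi_j(z_j),$$ we have $$y_k=\begin{cases}-c_k^-&\text{if }k\in\partial_{\mathcal U}^-,\\ c_k^+&\text{if }k\in\partial_{\mathcal U}^+,\end{cases}$$ where $\partial_{\mathcal U}^-=\{k\in\mathcal L:\sigma_k\in\mathcal M\setminus\mathcal U,\ \tau_k\in\mathcal U\}$ and $\partial_{\mathcal U}^+=\{k\in\mathcal L:\sigma_k\in\mathcal U,\ \tau_k\in\mathcal M\setminus\mathcal U\}$.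
   Context: Market network. $\mathcal N=\{1,\dots,n\}$ is a nonempty finite set of producers, $\mathcal M=\{1,\dots,m\}$ a finite set of markets, $\mathcal L=\{1,\dots,l\}$ a finite set of links. Each link $k$ has a tail $\sigma_k\in\mathcal M$ and a head $\tau_k\in\mathcal M\setminus\{\sigma_k\}$ (parallel links are allowed). A market network is a tuple $(A,B,c^-,c^+,H)$ where: $A\in\{0,1\}^{n\times m}$ is the producer-market adjacency matrix ($A_{ij}=1$ iff producer $i$ can sell on market $j$; every producer can sell on at least one market); $B\in\{0,\pm1\}^{m\times l}$ is the market-link incidence matrix, $B_{jk}=1$ if $\tau_k=j$, $B_{jk}=-1$ if $\sigma_k=j$, $B_{jk}=0$ otherwise; $c^-,c^+\in\mathbb{R}_+^l$ are capacity vectors; $H\in\mathbb{R}^{l\times l}$ satisfies $BH=B$ (here $H=I$). Standing assumption: the market network is weakly connected, i.e. any two distinct markets are joined by a path of links ignoring orientation (equivalently $\mathrm{rank}(B)=m-1$). A prime denotes matrix transpose. Game. Producer $i$ has action set $\mathcal A_i=\{v\in\mathbb{R}_+^m: A_{ij}=0\Rightarrow v_j=0\}$, with actions $x_i=(x_{ij})_{j\in\mathcal M}$; $\mathcal X=\prod_{i\in\mathcal N}\mathcal A_i\subseteq\mathbb{R}_+^{n\times m}$. The system operator (player $0$) has action set $\mathcal Y=\{y\in\mathbb{R}^l: -c^-\le Hy\le c^+\}$ (entrywise). Let $\operatorname{diag}(A'x)\in\mathbb{R}^m$ be the vector with entries $\sum_{i\in\mathcal N}A_{ij}x_{ij}$.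 The system operator's utility is $u_0(y,x)=\omega(x,\operatorname{diag}(A'x)+By)$, and its best response set to $x$ is $\mathcal B_0(x)=\arg\max_{y\in\mathcal Y}u_0(y,x)$. (Producers' utilities play no role in the claim.)
   Formalization: The inverse demand functions Φ_j are additionally assumed continuous; without this the claim fails (a jump of Φ_j at z_j can make an interior flow optimal) and the integrals may be undefined. *)

theory Defs
  imports "HOL-Analysis.Analysis"
begin

text \<open>
  Producers, markets and links are the elements of the finite types \<open>'n\<close>, \<open>'m\<close> and \<open>'l\<close>.
  The incidence matrix determines the link ends; both are kept as parameters, tied
  together by the assumption \<open>incidence\<close>. Vectors are ordered entrywise.
\<close>

locale market_network =
  fixes tail head :: "'l::finite \<Rightarrow> 'm::finite"
    and A :: "real ^ 'm ^ 'n::finite"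
    and B :: "real ^ 'l ^ 'm"
    and cminus cplus :: "real ^ 'l"
    and H :: "real ^ 'l ^ 'l"
  assumes no_loops: "\<And>k. head k \<noteq> tail k"
    and adjacency: "\<And>i j. A $ i $ j \<in> {0, 1}"
    and some_market: "\<And>i. \<exists>j. A $ i $ j = 1"
    and incidence:
      "\<And>j k. B $ j $ k = (if head k = j then 1 else if tail k = j then - 1 else 0)"
    and capacities: "0 \<le> cminus" "0 \<le> cplus"
    and BH: "B ** H = B"
    and weakly_connected:
      "\<And>j j'. (j, j') \<in> (range (\<lambda>k. (tail k, head k)) \<union> range (\<lambda>k. (head k, tail k)))\<^sup>*"

definition producer_actions :: "real ^ 'm ^ 'n \<Rightarrow> 'n \<Rightarrow> (real ^ 'm) set" where
  "producer_actions A i = {v. 0 \<le> v \<and> (\<forall>j. A $ i $ j = 0 \<longrightarrow> v $ j = 0)}"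

definition action_profiles :: "real ^ 'm ^ 'n \<Rightarrow> (real ^ 'm ^ 'n) set" where
  "action_profiles A = {x. \<forall>i. x $ i \<in> producer_actions A i}"

definition operator_actions ::
    "real ^ 'l \<Rightarrow> real ^ 'l \<Rightarrow> real ^ 'l ^ 'l \<Rightarrow> (real ^ 'l) set" where
  "operator_actions cminus cplus H = {y. - cminus \<le> H *v y \<and> H *v y \<le> cplus}"

definition diag :: "real ^ 'm ^ 'm \<Rightarrow> real ^ 'm" where
  "diag M = (\<chi> j. M $ j $ j)"

text \<open>
  The net supply on each market: the \<open>j\<close>-th entry of the first summand is
  \<open>\<Sum>i. A $ i $ j * x $ i $ j\<close>.
\<close>
definition net_supply ::
    "real ^ 'm ^ 'n \<Rightarrow> real ^ 'l ^ 'm \<Rightarrow> real ^ 'm ^ 'n \<Rightarrow> real ^ 'l \<Rightarrow> real ^ 'm" where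
  "net_supply A B x y = diag (transpose A ** x) + B *v y"

text \<open>
  The interval integral is oriented, so that negative net supplies
  are treated as in \<open>\<integral>\<^sub>0\<^sup>z = - \<integral>\<^sub>z\<^sup>0\<close>.
\<close>
definition walrasian_welfare ::
    "('n \<Rightarrow> real ^ 'm \<Rightarrow> real) \<Rightarrow> ('m \<Rightarrow> real \<Rightarrow> real) \<Rightarrow>
      real ^ 'm ^ 'n \<Rightarrow> real ^ 'm \<Rightarrow> real" where
  "walrasian_welfare \<Psi> \<Phi> x z =
    (\<Sum>j\<in>UNIV. LBINT s=0..ereal (z $ j). \<Phi> j s) - (\<Sum>i\<in>UNIV. \<Psi> i (x $ i))"

definition operator_utility ::
    "('n \<Rightarrow> real ^ 'm \<Rightarrow> real) \<Rightarrow> ('m \<Rightarrow> real \<Rightarrow> real) \<Rightarrow> real ^ 'm ^ 'n \<Rightarrow> real ^ 'l ^ 'm \<Rightarrow>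
      real ^ 'l \<Rightarrow> real ^ 'm ^ 'n \<Rightarrow> real" where
  "operator_utility \<Psi> \<Phi> A B y x = walrasian_welfare \<Psi> \<Phi> x (net_supply A B x y)"

definition operator_best_responses ::
    "('n \<Rightarrow> real ^ 'm \<Rightarrow> real) \<Rightarrow> ('m \<Rightarrow> real \<Rightarrow> real) \<Rightarrow> real ^ 'm ^ 'n \<Rightarrow> real ^ 'l ^ 'm \<Rightarrow>
      real ^ 'l \<Rightarrow> real ^ 'l \<Rightarrow> real ^ 'l ^ 'l \<Rightarrow> real ^ 'm ^ 'n \<Rightarrow> (real ^ 'l) set" where
  "operator_best_responses \<Psi> \<Phi> A B cminus cplus H x =
    {y. is_arg_max (\<lambda>y. operator_utility \<Psi> \<Phi> A B y x)
          (\<lambda>y. y \<in> operator_actions cminus cplus H) y}"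

definition in_boundary :: "('l \<Rightarrow> 'm) \<Rightarrow> ('l \<Rightarrow> 'm) \<Rightarrow> 'm set \<Rightarrow> 'l set" where
  "in_boundary tail head U = {k. tail k \<in> - U \<and> head k \<in> U}"

definition out_boundary :: "('l \<Rightarrow> 'm) \<Rightarrow> ('l \<Rightarrow> 'm) \<Rightarrow> 'm set \<Rightarrow> 'l set" where
  "out_boundary tail head U = {k. tail k \<in> U \<and> head k \<in> - U}"

end

theory Submission
  imports Defs
begin

text \<open>
  Moving a single flow \<open>y\<^sub>k\<close> changes the welfare at the rate \<open>\<Phi>\<^sub>h(z\<^sub>h) - \<Phi>\<^sub>t(z\<^sub>t)\<close>, the price gap
  between the head \<open>h\<close> and the tail \<open>t\<close> of the link. At a best response, a link with nonzero price
  gap is therefore saturated in the direction of the higher price. The links crossing the boundary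
  of \<open>U\<close> all have a price gap pointing out of \<open>U\<close>.
\<close>

text \<open>The fundamental theorem of calculus on a compact interval containing both the base point
  0 and \<open>x\<close>. Since 0 may lie on either side of \<open>x\<close>, the oriented integral
  covers both signs.\<close>

lemma has_real_derivative_interval_integral:
  fixes f :: "real \<Rightarrow> real"
  assumes "continuous_on UNIV f"
  shows "((\<lambda>u. LBINT s=0..ereal u. f s) has_real_derivative f x) (at x)"
proof -
  \<comment> \<open>The margins of 1 put \<open>x\<close> in the interior of the interval, so the
    derivative within \<open>{a..b}\<close> is a two-sided one.\<close>
  define a b where "a = min 0 x - 1" and "b = max 0 x + 1"
  have ab: "a \<le> 0" "0 \<le> b" "a < x" "x < b"
    by (auto simp: a_def b_def)
  have "((\<lambda>u. LBINT s=ereal 0..ereal u. f s) has_vector_derivative f x) (at x within {a..b})"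
    using ab by (intro interval_integral_FTC2 continuous_on_subset[OF assms]) auto
  moreover have "at x within {a..b} = at x"
    using ab by (intro at_within_interior) auto
  ultimately show ?thesis
    by (simp add: has_real_derivative_iff_has_vector_derivative zero_ereal_def)
qed

context market_network
begin

text \<open>Column \<open>k\<close> of \<open>B\<close> has only two nonzero entries, 1 at the head
  and -1 at the tail; these positions differ because there are no loops.\<close>

lemma sum_incidence_column:
  "(\<Sum>j\<in>UNIV. f j * B $ j $ k) = f (head k) - f (tail k)"
proof -
  have "f j * B $ j $ k = (if head k = j then f j else 0) - (if tail k = j then f j else 0)" for j
    using no_loops[of k] by (auto simp: incidence)
  then show ?thesis
    by (simp add: sum_subtractf sum.delta')
qed

lemma has_real_derivative_operator_utility:
  fixes x :: "real ^ 'm ^ 'n" and y :: "real ^ 'l"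
  assumes "\<And>j. continuous_on UNIV (\<Phi> j)"
  defines "p \<equiv> \<lambda>j. \<Phi> j (net_supply A B x y $ j)"
  shows "((\<lambda>t. operator_utility \<Psi> \<Phi> A B (y + t *\<^sub>R axis k 1) x) has_real_derivative
           p (head k) - p (tail k)) (at 0)"
proof -
  let ?z = "net_supply A B x y"
  \<comment> \<open>\<open>B\<close> maps the \<open>k\<close>-th unit vector to its
    \<open>k\<close>-th column, so each net supply is affine in \<open>t\<close>.\<close>
  have supply_shift: "net_supply A B x (y + t *\<^sub>R axis k 1) $ j = ?z $ j + t * B $ j $ k" for t j
    by (simp add: net_supply_def matrix_vector_right_distrib matrix_vector_mult_scaleR
        matrix_vector_mul_component inner_axis column_def matrix_vector_mult_basis)
  have "((\<lambda>t. LBINT s=0..ereal (?z $ j + t * B $ j $ k). \<Phi> j s) has_real_derivative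
          p j * B $ j $ k) (at 0)" for j
  proof (rule DERIV_chain2[where f = "\<lambda>u. LBINT s=0..ereal u. \<Phi> j s"])
    show "((\<lambda>u. LBINT s=0..ereal u. \<Phi> j s) has_real_derivative p j)
            (at (?z $ j + 0 * B $ j $ k))"
      using has_real_derivative_interval_integral[OF assms(1)] by (simp add: p_def)
  qed (auto intro!: derivative_eq_intros)
  \<comment> \<open>Production costs depend on \<open>x\<close> alone and are constant in
    \<open>t\<close>.\<close>
  then have "((\<lambda>t. (\<Sum>j\<in>UNIV. LBINT s=0..ereal (?z $ j + t * B $ j $ k). \<Phi> j s)
                 - (\<Sum>i\<in>UNIV. \<Psi> i (x $ i))) has_real_derivative
               (\<Sum>j\<in>UNIV. p j * B $ j $ k) - 0) (at 0)"
    by (intro DERIV_diff DERIV_sum DERIV_const) auto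
  then show ?thesis
    by (simp add: operator_utility_def walrasian_welfare_def supply_shift sum_incidence_column)
qed

lemma best_response_saturates_link:
  fixes x :: "real ^ 'm ^ 'n" and y :: "real ^ 'l"
  assumes H: "H = mat 1"
    and cont: "\<And>j. continuous_on UNIV (\<Phi> j)"
    and best: "y \<in> operator_best_responses \<Psi> \<Phi> A B cminus cplus H x"
  defines "p \<equiv> \<lambda>j. \<Phi> j (net_supply A B x y $ j)"
  shows "p (head k) < p (tail k) \<Longrightarrow> y $ k = - (cminus $ k)"
    and "p (tail k) < p (head k) \<Longrightarrow> y $ k = cplus $ k"
proof -
  define g where "g t = operator_utility \<Psi> \<Phi> A B (y + t *\<^sub>R axis k 1) x" for t
  have deriv: "(g has_real_derivative p (head k) - p (tail k)) (at 0)"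
    unfolding g_def p_def by (rule has_real_derivative_operator_utility[OF cont])
  have feasible: "- cminus $ i \<le> y $ i" "y $ i \<le> cplus $ i" for i
    using best by (auto simp: operator_best_responses_def is_arg_max_def operator_actions_def H
        less_eq_vec_def)
  \<comment> \<open>With \<open>H\<close> the identity the feasible set is a box, so a move along
    coordinate \<open>k\<close> has to respect only the two capacities of link
    \<open>k\<close>.\<close>
  have opt: "g t \<le> g 0" if "- cminus $ k \<le> y $ k + t" "y $ k + t \<le> cplus $ k" for t
  proof -
    have "y + t *\<^sub>R axis k 1 \<in> operator_actions cminus cplus H"
      using that feasible by (auto simp: operator_actions_def H less_eq_vec_def axis_def)
    then show ?thesis
      using best by (auto simp: operator_best_responses_def is_arg_max_def g_def not_less)
  qed
  show "y $ k = - (cminus $ k)" if gap: "p (head k) < p (tail k)"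
  proof (rule ccontr)
    assume "y $ k \<noteq> - (cminus $ k)"
    then have slack: "0 < y $ k + cminus $ k"
      using feasible(1)[of k] by simp
    obtain d where "d > 0" and d: "\<And>h. 0 < h \<Longrightarrow> h < d \<Longrightarrow> g 0 < g (0 - h)"
      using DERIV_neg_dec_left[OF deriv] gap by auto
    \<comment> \<open>The bound \<open>d / 2\<close> keeps the step strictly inside the range where
      lowering the flow raises welfare; the slack keeps the lower capacity satisfied.\<close>
    define h where "h = min (d / 2) (y $ k + cminus $ k)"
    have "g 0 < g (0 - h)"
      using slack \<open>d > 0\<close> by (intro d) (auto simp: h_def)
    moreover have "g (0 - h) \<le> g 0"
      using slack \<open>d > 0\<close> feasible(2)[of k] by (intro opt) (auto simp: h_def)
    ultimately show False by simp
  qed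
  show "y $ k = cplus $ k" if gap: "p (tail k) < p (head k)"
  proof (rule ccontr)
    assume "y $ k \<noteq> cplus $ k"
    then have slack: "0 < cplus $ k - y $ k"
      using feasible(2)[of k] by simp
    obtain d where "d > 0" and d: "\<And>h. 0 < h \<Longrightarrow> h < d \<Longrightarrow> g 0 < g (0 + h)"
      using DERIV_pos_inc_right[OF deriv] gap by auto
    \<comment> \<open>The mirror image: raising the flow pays, and the step is limited by the slack
      to the upper capacity.\<close>
    define h where "h = min (d / 2) (cplus $ k - y $ k)"
    have "g 0 < g (0 + h)"
      using slack \<open>d > 0\<close> by (intro d) (auto simp: h_def)
    moreover have "g (0 + h) \<le> g 0"
      using slack \<open>d > 0\<close> feasible(1)[of k] by (intro opt) (auto simp: h_def)
    ultimately show False by simp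
  qed
qed

end

theorem corollary1:
  fixes tail head :: "'l::finite \<Rightarrow> 'm::finite"
    and A :: "real ^ 'm ^ 'n::finite"
    and B :: "real ^ 'l ^ 'm"
    and cminus cplus :: "real ^ 'l"
    and H :: "real ^ 'l ^ 'l"
    and \<Psi> :: "'n \<Rightarrow> real ^ 'm \<Rightarrow> real"
    and \<Phi> :: "'m \<Rightarrow> real \<Rightarrow> real"
    and x :: "real ^ 'm ^ 'n"
    and y :: "real ^ 'l"
    and z :: "real ^ 'm"
    and U :: "'m set"
  assumes "market_network tail head A B cminus cplus H"
    and "H = mat 1"
    and "\<And>i v. 0 \<le> v \<Longrightarrow> 0 \<le> \<Psi> i v"
    and "\<And>j. continuous_on UNIV (\<Phi> j)"
    and "x \<in> action_profiles A"
    and "y \<in> operator_best_responses \<Psi> \<Phi> A B cminus cplus H x"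
    and "z = net_supply A B x y"
    and "U \<noteq> {}" and "U \<subset> UNIV"
    and "Max ((\<lambda>j. \<Phi> j (z $ j)) ` U) < Min ((\<lambda>j. \<Phi> j (z $ j)) ` (- U))"
  shows "(\<forall>k \<in> in_boundary tail head U. y $ k = - (cminus $ k)) \<and>
         (\<forall>k \<in> out_boundary tail head U. y $ k = cplus $ k)"
proof -
  have gap: "\<Phi> i (z $ i) < \<Phi> j (z $ j)" if "i \<in> U" "j \<in> - U" for i j
  proof -
    have "\<Phi> i (z $ i) \<le> Max ((\<lambda>j. \<Phi> j (z $ j)) ` U)"
      using that by (intro Max_ge) auto
    also have "\<dots> < Min ((\<lambda>j. \<Phi> j (z $ j)) ` (- U))"
      by fact
    also have "\<dots> \<le> \<Phi> j (z $ j)"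
      using that by (intro Min_le) auto
    finally show ?thesis .
  qed
  note saturated = market_network.best_response_saturates_link[OF assms(1,2,4,6), folded assms(7)]
  \<comment> \<open>An inward link has its head in \<open>U\<close>, on the cheaper side, and sits
    at its lower bound; an outward link has its tail there and sits at its upper bound.\<close>
  show ?thesis
    using saturated gap by (auto simp: in_boundary_def out_boundary_def)
qed

end
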